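(* Let $k\in\mathbb N$, let $\mathcal X$ be an inner product space over $\mathbb F\in\{\mathbb R,\mathbb C\}$ of dimension at least $k$ (possibly infinite), and let $\mathcal I$ be a non-trivial admissible ideal in $\mathbb N$. Let $U_n$ ($n\in\mathbb N$) and $V$ be $k$-dimensional subspaces of $\mathcal X$, let $\{u^{(n)}_1,\dots,u^{(n)}_k\}$ be an orthonormal basis of $U_n$ for each $n$, and let $\{v_1,\dots,v_k\}$ be an orthonormal basis of $V$. Then the following statements are equivalent: (i) $\mathcal I\text{-}\lim_{n\to\infty}U_n=V$; (ii) $\mathcal I\text{-}\lim_{n\to\infty}\|u^{(n)}_i-P_V(u^{(n)}_i)\|=0$ for all $i=1,2,\dots,k$; (iii) $\mathcal I\text{-}\lim_{n\to\infty}\sum_{j=1}^k|\langle u^{(n)}_i,v_j\rangle|^2=1$ for all $i=1,2,\dots,k$; (iv) $\mathcal I\text{-}\lim_{n\to\infty}\|P_V(u^{(n)}_i)\|=1$ for all $i=1,2,\dots,k$; (v) $\mathcal I\text{-}\lim_{n\to\infty}\|u^{(n)}_i,v_1,v_2,\dots,v_k\|=0$ for all $i=1,2,\dots,k$, where $\|\cdot,\dots,\cdot\|$ is the standard $(k+1)$-norm on $\mathcal X$.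
   Context: An ideal in $\mathbb N$ is a non-empty family $\mathcal I$ of subsets of $\mathbb N$ containing $\emptyset$, closed under finite unions and under taking subsets. It is non-trivial if $\mathbb N\notin\mathcal I$ and $\mathcal I\ne\{\emptyset\}$, and admissible if $\{m\}\in\mathcal I$ for every $m\in\mathbb N$. A real sequence $(x_n)$ is $\mathcal I$-convergent to $x\in\mathbb R$, written $\mathcal I\text{-}\lim_{n\to\infty}x_n=x$, if $\{n\in\mathbb N:|x_n-x|\ge\epsilon\}\in\mathcal I$ for every $\epsilon>0$. The inner product is linear in the first variable and $\|x\|=\sqrt{\langle x,x\rangle}$. $P_V$ denotes the orthogonal projection onto $V$: $P_V(u)=\sum_{j=1}^k\langle u,v_j\rangle v_j$. A sequence $(U_n)$ of $k$-dimensional subspaces is $\mathcal I$-convergent to the $k$-dimensional subspace $V$, written $\mathcal I\text{-}\lim_{n\to\infty}U_n=V$, if for every $\epsilon>0$ the set $\{n\in\mathbb N:\sup_{u\in U_n,\|u\|=1}\|u-P_V(u)\|\ge\epsilon\}$ belongs to $\mathcal I$. The standard $m$-norm of vectors $x_1,\dots,x_m\in\mathcal X$ is $\|x_1,\dots,x_m\|=\sqrt{G(x_1,\dots,x_m)}$, where $G(x_1,\dots,x_m)=\det\big(\langle x_p,x_q\rangle\big)_{1\le p,q\le m}$ is the Gram determinant (a non-negative real number). *)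

theory Defs
  imports Complex_Main "Jordan_Normal_Form.Determinant"
begin

section \<open>Scalars\<close>

text \<open>
  The scalar field is \<open>\<real>\<close> or \<open>\<complex>\<close>.  By the Gelfand--Mazur theorem a \<^class>\<open>real_normed_field\<close> (whose
  norm is multiplicative) is isomorphic to one of the two, and \<open>x * rc_conj x = |x|\<^sup>2\<close> and
  \<open>x + rc_conj x = 2 * rc_re x\<close> determine the conjugation and the real part.  So the class has no
  models other than the two instances below.
\<close>

class rc_field = real_normed_field +
  fixes rc_conj :: "'a \<Rightarrow> 'a" and rc_re :: "'a \<Rightarrow> real"
  assumes rc_conj_add: "rc_conj (x + y) = rc_conj x + rc_conj y"
    and rc_conj_mult: "rc_conj (x * y) = rc_conj x * rc_conj y"
    and rc_conj_conj: "rc_conj (rc_conj x) = x"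
    and rc_mult_conj: "x * rc_conj x = (norm x)\<^sup>2 *\<^sub>R 1"
    and rc_add_conj: "x + rc_conj x = (2 * rc_re x) *\<^sub>R 1"

instantiation real :: rc_field
begin
definition rc_conj_real :: "real \<Rightarrow> real" where "rc_conj_real x = x"
definition rc_re_real :: "real \<Rightarrow> real" where "rc_re_real x = x"
instance
  by standard (auto simp: rc_conj_real_def rc_re_real_def power2_eq_square)
end

instantiation complex :: rc_field
begin
definition rc_conj_complex :: "complex \<Rightarrow> complex" where "rc_conj_complex = cnj"
definition rc_re_complex :: "complex \<Rightarrow> real" where "rc_re_complex = Re"
instance
proof
  fix x y :: complex
  show "rc_conj (x + y) = rc_conj x + rc_conj y" "rc_conj (x * y) = rc_conj x * rc_conj y"
    "rc_conj (rc_conj x) = x"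
    by (simp_all add: rc_conj_complex_def)
  show "x * rc_conj x = (norm x)\<^sup>2 *\<^sub>R 1"
    unfolding rc_conj_complex_def complex_norm_square[symmetric] scaleR_conv_of_real by simp
  show "x + rc_conj x = (2 * rc_re x) *\<^sub>R 1"
    unfolding rc_conj_complex_def rc_re_complex_def complex_add_cnj scaleR_conv_of_real by simp
qed
end

section \<open>Inner product spaces\<close>

locale inner_product_space = vector_space scale
  for scale :: "'f::rc_field \<Rightarrow> 'a::ab_group_add \<Rightarrow> 'a" +
  fixes ip :: "'a \<Rightarrow> 'a \<Rightarrow> 'f"
  assumes ip_add_left: "ip (x + y) z = ip x z + ip y z"
    and ip_scale_left: "ip (scale a x) y = a * ip x y"
    and ip_conj_sym: "ip x y = rc_conj (ip y x)"
    and ip_self_nonneg: "0 \<le> rc_re (ip x x)"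
    and ip_self_eq_0: "ip x x = 0 \<Longrightarrow> x = 0"

definition ip_norm :: "('a \<Rightarrow> 'a \<Rightarrow> 'f::rc_field) \<Rightarrow> 'a \<Rightarrow> real" where
  "ip_norm ip x = sqrt (rc_re (ip x x))"

definition orth_proj :: "('a::ab_group_add \<Rightarrow> 'a \<Rightarrow> 'f::rc_field) \<Rightarrow> 'a set \<Rightarrow> 'a \<Rightarrow> 'a" where
  "orth_proj ip V u = (THE p. p \<in> V \<and> (\<forall>w\<in>V. ip (u - p) w = 0))"

text \<open>
  For infinite-dimensional \<open>S\<close> the library's \<open>dim S\<close> is \<open>0\<close>, so \<open>dim S = k\<close> with \<open>k \<ge> 1\<close> forces \<open>S\<close> to
  be finite-dimensional, whereas a lower bound on the dimension of the whole space has to allow the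
  infinite-dimensional case separately.
\<close>

definition dim_at_least :: "('f::field \<Rightarrow> 'a::ab_group_add \<Rightarrow> 'a) \<Rightarrow> nat \<Rightarrow> bool" where
  "dim_at_least scale k \<longleftrightarrow>
     ((\<exists>B. finite B \<and> module.span scale B = UNIV) \<longrightarrow> k \<le> vector_space.dim scale UNIV)"

definition k_subspace :: "('f::field \<Rightarrow> 'a::ab_group_add \<Rightarrow> 'a) \<Rightarrow> nat \<Rightarrow> 'a set \<Rightarrow> bool" where
  "k_subspace scale k S \<longleftrightarrow> module.subspace scale S \<and> vector_space.dim scale S = k"

text \<open>Finite families \<open>v\<^sub>1, \<dots>, v\<^sub>k\<close> are functions on \<^typ>\<open>nat\<close>, of which only the values on \<open>{1..k}\<close> matter.\<close>

definition orthonormal_basis ::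
    "('f::rc_field \<Rightarrow> 'a::ab_group_add \<Rightarrow> 'a) \<Rightarrow> ('a \<Rightarrow> 'a \<Rightarrow> 'f) \<Rightarrow> nat \<Rightarrow> (nat \<Rightarrow> 'a) \<Rightarrow> 'a set \<Rightarrow> bool"
  where
  "orthonormal_basis scale ip k v S \<longleftrightarrow>
     (\<forall>i\<in>{1..k}. \<forall>j\<in>{1..k}. ip (v i) (v j) = (if i = j then 1 else 0)) \<and>
     \<not> module.dependent scale (v ` {1..k}) \<and> module.span scale (v ` {1..k}) = S"

text \<open>A Gram determinant is a non-negative real, so \<^const>\<open>rc_re\<close> only changes its type.\<close>

definition gram_det :: "('a \<Rightarrow> 'a \<Rightarrow> 'f::rc_field) \<Rightarrow> 'a list \<Rightarrow> 'f" where
  "gram_det ip xs = det (mat (length xs) (length xs) (\<lambda>(p, q). ip (xs ! p) (xs ! q)))"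

definition std_norm :: "('a \<Rightarrow> 'a \<Rightarrow> 'f::rc_field) \<Rightarrow> 'a list \<Rightarrow> real" where
  "std_norm ip xs = sqrt (rc_re (gram_det ip xs))"

section \<open>Ideal convergence\<close>

definition set_ideal :: "nat set set \<Rightarrow> bool" where
  "set_ideal \<I> \<longleftrightarrow> {} \<in> \<I> \<and> (\<forall>A\<in>\<I>. \<forall>B\<in>\<I>. A \<union> B \<in> \<I>) \<and> (\<forall>A\<in>\<I>. \<forall>B. B \<subseteq> A \<longrightarrow> B \<in> \<I>)"

definition nontrivial_ideal :: "nat set set \<Rightarrow> bool" where
  "nontrivial_ideal \<I> \<longleftrightarrow> UNIV \<notin> \<I> \<and> \<I> \<noteq> {{}}"

definition admissible_ideal :: "nat set set \<Rightarrow> bool" where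
  "admissible_ideal \<I> \<longleftrightarrow> (\<forall>m. {m} \<in> \<I>)"

definition ideal_lim :: "nat set set \<Rightarrow> (nat \<Rightarrow> real) \<Rightarrow> real \<Rightarrow> bool" where
  "ideal_lim \<I> x l \<longleftrightarrow> (\<forall>\<epsilon>>0. {n. \<bar>x n - l\<bar> \<ge> \<epsilon>} \<in> \<I>)"

definition ideal_lim_subspace ::
    "('a::ab_group_add \<Rightarrow> 'a \<Rightarrow> 'f::rc_field) \<Rightarrow> nat set set \<Rightarrow> (nat \<Rightarrow> 'a set) \<Rightarrow> 'a set \<Rightarrow> bool" where
  "ideal_lim_subspace ip \<I> U V \<longleftrightarrow>
     (\<forall>\<epsilon>>0. {n. (SUP u\<in>{u \<in> U n. ip_norm ip u = 1}. ip_norm ip (u - orth_proj ip V u)) \<ge> \<epsilon>} \<in> \<I>)"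

section \<open>The projection in coordinates\<close>

context inner_product_space
begin

lemma ip_zero_left: "ip 0 z = 0"
  using ip_add_left[of 0 0 z] by simp

lemma ip_diff_left: "ip (x - y) z = ip x z - ip y z"
  using ip_add_left[of "x - y" y z] by (simp add: algebra_simps)

lemma ip_sum_left: "ip (sum f A) z = (\<Sum>i\<in>A. ip (f i) z)"
  by (induction A rule: infinite_finite_induct) (simp_all add: ip_zero_left ip_add_left)

lemma ip_eq_0_sym: "ip x y = 0 \<Longrightarrow> ip y x = 0"
  using ip_conj_sym[of y x] rc_conj_add[of "0::'f" 0] by simp

lemma subspace_orth_left: "subspace {w. ip w y = 0}"
  by (auto simp: subspace_def ip_zero_left ip_add_left ip_scale_left)

theorem orth_proj_eq_sum:
  assumes "orthonormal_basis scale ip k v V"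
  shows "orth_proj ip V u = (\<Sum>j=1..k. scale (ip u (v j)) (v j))"
proof -
  let ?p = "\<Sum>j=1..k. scale (ip u (v j)) (v j)"
  from assms have on: "\<And>i j. i \<in> {1..k} \<Longrightarrow> j \<in> {1..k} \<Longrightarrow> ip (v i) (v j) = (if i = j then 1 else 0)"
    and V: "V = span (v ` {1..k})"
    by (auto simp: orthonormal_basis_def)
  have pV: "?p \<in> V"
    unfolding V by (intro span_sum span_scale span_base) auto
  have orth_v: "ip (u - ?p) (v i) = 0" if "i \<in> {1..k}" for i
  proof -
    have "ip ?p (v i) = (\<Sum>j=1..k. ip u (v j) * (if j = i then 1 else 0))"
      unfolding ip_sum_left ip_scale_left using on that by (intro sum.cong) auto
    also have "\<dots> = ip u (v i)"
      using that by (simp add: if_distrib[of "(*) _"] cong: if_cong)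
    finally show ?thesis
      by (simp add: ip_diff_left)
  qed
  have "V \<subseteq> {w. ip w (u - ?p) = 0}"
    unfolding V
    by (rule span_minimal[OF _ subspace_orth_left]) (use ip_eq_0_sym[OF orth_v] in auto)
  then have orth: "\<forall>w\<in>V. ip (u - ?p) w = 0"
    using ip_eq_0_sym by blast
  show ?thesis
    unfolding orth_proj_def
  proof (rule the_equality)
    show "?p \<in> V \<and> (\<forall>w\<in>V. ip (u - ?p) w = 0)"
      using pV orth by blast
  next
    fix q assume q: "q \<in> V \<and> (\<forall>w\<in>V. ip (u - q) w = 0)"
    have "q - ?p \<in> V"
      using q pV unfolding V by (auto intro: span_diff)
    then have "ip (u - ?p) (q - ?p) = 0" "ip (u - q) (q - ?p) = 0"
      using q orth by auto
    then have "ip ((u - ?p) - (u - q)) (q - ?p) = 0"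
      by (subst ip_diff_left) simp
    then have "ip (q - ?p) (q - ?p) = 0"
      by simp
    then show "q = ?p"
      using ip_self_eq_0[of "q - ?p"] by simp
  qed
qed

end

end

theory Submission
  imports Defs
begin

text \<open>
  For a unit vector \<open>x\<close> put \<open>S x = (\<Sum>j. |\<langle>x, v\<^sub>j\<rangle>|\<^sup>2)\<close>.  Pythagoras gives \<open>\<parallel>P x\<parallel>\<^sup>2 = S x\<close> and
  \<open>\<parallel>x - P x\<parallel>\<^sup>2 = 1 - S x\<close>, and the Gram determinant of \<open>x, v\<^sub>1, \<dots>, v\<^sub>k\<close>, being a Schur complement,
  is \<open>1 - S x\<close> as well; so (ii)--(v) are equivalent by continuity of the square root.  If
  \<open>x = (\<Sum>i. a\<^sub>i u\<^sub>i)\<close> is a unit vector of \<open>U\<close>, then \<open>|a\<^sub>i| \<le> 1\<close> and hence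
  \<open>\<parallel>x - P x\<parallel> \<le> (\<Sum>i. \<parallel>u\<^sub>i - P u\<^sub>i\<parallel>)\<close>, which squeezes the supremum in (i).  Ideal convergence
  is convergence along the filter of complements of members of the ideal.
\<close>

section \<open>Ideal convergence as convergence along a filter\<close>

definition ideal_filter :: "nat set set \<Rightarrow> nat filter" where
  "ideal_filter \<I> = Abs_filter (\<lambda>P. {n. \<not> P n} \<in> \<I>)"

text \<open>The filter axioms mirror the ideal axioms under complement: unions give conjunctions,
  subsets give monotonicity. This check is what lets \<open>Abs_filter\<close> be unfolded.\<close>

lemma eventually_ideal_filter:
  assumes "set_ideal \<I>"
  shows "eventually P (ideal_filter \<I>) \<longleftrightarrow> {n. \<not> P n} \<in> \<I>"
  unfolding ideal_filter_def
proof (rule eventually_Abs_filter, rule is_filter.intro)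
  have un: "A \<union> B \<in> \<I>" if "A \<in> \<I>" "B \<in> \<I>" for A B
    using assms that unfolding set_ideal_def by blast
  have sub: "B \<in> \<I>" if "A \<in> \<I>" "B \<subseteq> A" for A B
    using assms that unfolding set_ideal_def by blast
  show "{n. \<not> True} \<in> \<I>"
    using assms by (simp add: set_ideal_def)
  fix P Q :: "nat \<Rightarrow> bool"
  assume P: "{n. \<not> P n} \<in> \<I>"
  show "{n. \<not> (P n \<and> Q n)} \<in> \<I>" if "{n. \<not> Q n} \<in> \<I>"
    by (rule sub[OF un[OF P that]]) auto
  show "{n. \<not> Q n} \<in> \<I>" if "\<forall>x. P x \<longrightarrow> Q x"
    by (rule sub[OF P]) (use that in auto)
qed

text \<open>Makes the squeeze, sum and square-root rules for limits available for ideal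
  convergence.\<close>

lemma ideal_lim_iff_tendsto:
  assumes "set_ideal \<I>"
  shows "ideal_lim \<I> x l \<longleftrightarrow> (x \<longlongrightarrow> l) (ideal_filter \<I>)"
  unfolding ideal_lim_def tendsto_iff eventually_ideal_filter[OF assms] dist_real_def not_less ..

lemma tendsto_sqrt_iff:
  assumes "\<And>n. 0 \<le> f n" "0 \<le> l"
  shows "((\<lambda>n. sqrt (f n)) \<longlongrightarrow> sqrt l) F \<longleftrightarrow> (f \<longlongrightarrow> l) F"
proof
  assume "((\<lambda>n. sqrt (f n)) \<longlongrightarrow> sqrt l) F"
  then have "((\<lambda>n. (sqrt (f n))\<^sup>2) \<longlongrightarrow> (sqrt l)\<^sup>2) F"
    by (rule tendsto_power)
  then show "(f \<longlongrightarrow> l) F"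
    by (simp add: assms)
qed (rule tendsto_real_sqrt)

section \<open>Conjugation and real part\<close>

lemma rc_conj_0 [simp]: "rc_conj (0::'f::rc_field) = 0"
  using rc_conj_add[of "0::'f" 0] by simp

text \<open>Not a class axiom: cancel \<open>of_real r\<close> in \<open>rc_mult_conj\<close>, hence
  the separate case of zero.\<close>

lemma rc_conj_of_real [simp]: "rc_conj (of_real r :: 'f::rc_field) = of_real r"
proof (cases "r = 0")
  case False
  have "(of_real r :: 'f) * rc_conj (of_real r) = of_real r * of_real r"
    by (simp add: rc_mult_conj scaleR_conv_of_real power2_eq_square)
  with False show ?thesis
    by simp
qed simp

lemma of_real_rc_re: "rc_conj x = x \<Longrightarrow> of_real (rc_re x) = (x::'f::rc_field)"
  using rc_add_conj[of x] by (simp add: scaleR_conv_of_real flip: mult_2)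

lemma rc_re_of_real [simp]: "rc_re (of_real r :: 'f::rc_field) = r"
  using of_real_rc_re[of "of_real r :: 'f"] by simp

section \<open>Geometry of inner product spaces\<close>

context inner_product_space
begin

lemma ip_add_right: "ip z (x + y) = ip z x + ip z y"
  by (metis ip_add_left ip_conj_sym rc_conj_add)

text \<open>Conjugate symmetry makes \<open>ip x x\<close> self-conjugate, hence real. Identities
  between squared norms can thus be proved in the scalar field and pulled back by injectivity of
  \<open>of_real\<close>.\<close>

lemma ip_self: "ip x x = of_real ((ip_norm ip x)\<^sup>2)"
  using of_real_rc_re[OF ip_conj_sym[symmetric, of x x]] ip_self_nonneg[of x]
  by (simp add: ip_norm_def flip: of_real_power)

lemma ip_norm_nonneg [simp]: "0 \<le> ip_norm ip x"
  using ip_self_nonneg[of x] by (simp add: ip_norm_def)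

lemma ip_norm_eq_sqrt: "ip x x = of_real r \<Longrightarrow> ip_norm ip x = sqrt r"
  by (simp add: ip_norm_def)

lemma pythagoras:
  assumes "ip x y = 0"
  shows "(ip_norm ip (x + y))\<^sup>2 = (ip_norm ip x)\<^sup>2 + (ip_norm ip y)\<^sup>2"
proof -
  have "(of_real ((ip_norm ip (x + y))\<^sup>2) :: 'f) = of_real ((ip_norm ip x)\<^sup>2 + (ip_norm ip y)\<^sup>2)"
    unfolding of_real_add ip_self[symmetric]
    by (simp add: ip_add_left ip_add_right assms ip_eq_0_sym[OF assms])
  then show ?thesis
    by (simp only: of_real_eq_iff)
qed

lemma ip_norm_scale: "ip_norm ip (scale a x) = norm a * ip_norm ip x"
proof -
  have "ip x (scale a x) = rc_conj a * ip x x"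
    by (metis ip_conj_sym ip_scale_left rc_conj_mult)
  then have "ip (scale a x) (scale a x) = (a * rc_conj a) * ip x x"
    by (simp add: ip_scale_left ac_simps)
  also have "\<dots> = of_real ((norm a * ip_norm ip x)\<^sup>2)"
    by (simp add: rc_mult_conj ip_self scaleR_conv_of_real power_mult_distrib)
  finally show ?thesis
    by (simp add: ip_norm_eq_sqrt del: of_real_power of_real_mult)
qed

lemma cauchy_schwarz: "norm (ip x y) \<le> ip_norm ip x * ip_norm ip y"
proof (cases "ip_norm ip y = 0")
  case True
  then have "y = 0"
    using ip_self[of y] ip_self_eq_0 by simp
  then have "ip x y = 0"
    using ip_eq_0_sym[OF ip_zero_left] by simp
  then show ?thesis
    by simp
next
  case False
  then have nz: "ip y y \<noteq> 0"
    by (simp add: ip_self)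
  \<comment> \<open>This \<open>c\<close> makes \<open>x - scale c y\<close> orthogonal to
    \<open>y\<close>; Pythagoras then bounds the norm of \<open>scale c y\<close> by that of
    \<open>x\<close>.\<close>
  define c where "c = ip x y / ip y y"
  have "ip (x - scale c y) y = 0"
    using nz by (simp add: ip_diff_left ip_scale_left c_def)
  then have "ip (x - scale c y) (scale c y) = 0"
    by (metis ip_eq_0_sym ip_scale_left mult_zero_right)
  from pythagoras[OF this]
  have "(norm c * ip_norm ip y)\<^sup>2 \<le> (ip_norm ip x)\<^sup>2"
    by (simp add: ip_norm_scale)
  then have "norm c * ip_norm ip y \<le> ip_norm ip x"
    by (rule power2_le_imp_le) simp
  moreover have "norm c * ip_norm ip y = norm (ip x y) / ip_norm ip y"
    using False by (simp add: c_def ip_self norm_divide norm_mult power2_eq_square)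
  moreover have "0 < ip_norm ip y"
    using False ip_norm_nonneg[of y] by linarith
  ultimately show ?thesis
    by (simp add: pos_divide_le_eq)
qed

text \<open>Pair the combination with itself, apply Cauchy-Schwarz to each term and cancel one
  factor of its norm; norm zero is treated apart.\<close>

lemma ip_norm_lincomb_le:
  assumes "\<And>i. i \<in> A \<Longrightarrow> norm (a i) \<le> 1"
  shows "ip_norm ip (\<Sum>i\<in>A. scale (a i) (w i)) \<le> (\<Sum>i\<in>A. ip_norm ip (w i))"
proof -
  let ?w = "\<Sum>i\<in>A. scale (a i) (w i)"
  have "(ip_norm ip ?w)\<^sup>2 = norm (ip ?w ?w)"
    by (simp add: ip_self del: of_real_power)
  also have "\<dots> = norm (\<Sum>i\<in>A. a i * ip (w i) ?w)"
    by (subst ip_sum_left) (simp add: ip_scale_left)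
  also have "\<dots> \<le> (\<Sum>i\<in>A. norm (a i * ip (w i) ?w))"
    by (rule norm_sum)
  also have "\<dots> \<le> (\<Sum>i\<in>A. ip_norm ip (w i) * ip_norm ip ?w)"
  proof (rule sum_mono)
    fix i assume "i \<in> A"
    have "norm (a i * ip (w i) ?w) \<le> 1 * (ip_norm ip (w i) * ip_norm ip ?w)"
      unfolding norm_mult
      by (rule mult_mono[OF assms[OF \<open>i \<in> A\<close>] cauchy_schwarz]) simp_all
    then show "norm (a i * ip (w i) ?w) \<le> ip_norm ip (w i) * ip_norm ip ?w"
      by simp
  qed
  finally have le: "ip_norm ip ?w * ip_norm ip ?w \<le> (\<Sum>i\<in>A. ip_norm ip (w i)) * ip_norm ip ?w"
    by (simp add: sum_distrib_right power2_eq_square)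
  show ?thesis
  proof (cases "ip_norm ip ?w = 0")
    case True
    then show ?thesis
      by (simp add: sum_nonneg)
  next
    case False
    then have "0 < ip_norm ip ?w"
      using ip_norm_nonneg[of ?w] by linarith
    with le show ?thesis
      by simp
  qed
qed

section \<open>Orthonormal bases and orthogonal projections\<close>

lemma orthonormal_basis_ip:
  "\<lbrakk>orthonormal_basis scale ip k v V; i \<in> {1..k}; j \<in> {1..k}\<rbrakk> \<Longrightarrow>
    ip (v i) (v j) = (if i = j then 1 else 0)"
  by (simp add: orthonormal_basis_def)

lemma ip_norm_orthonormal_basis:
  assumes "orthonormal_basis scale ip k v V" "i \<in> {1..k}"
  shows "ip_norm ip (v i) = 1"
  using ip_norm_eq_sqrt[of "v i" 1] orthonormal_basis_ip[OF assms(1,2,2)] by simp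

lemma orthonormal_basis_in:
  "\<lbrakk>orthonormal_basis scale ip k v V; i \<in> {1..k}\<rbrakk> \<Longrightarrow> v i \<in> V"
  unfolding orthonormal_basis_def by (auto intro: span_base)

lemma orth_proj_ip_basis:
  assumes "orthonormal_basis scale ip k v V" "i \<in> {1..k}"
  shows "ip (orth_proj ip V x) (v i) = ip x (v i)"
proof -
  have "ip (orth_proj ip V x) (v i) = (\<Sum>j=1..k. ip x (v j) * ip (v j) (v i))"
    by (simp add: orth_proj_eq_sum[OF assms(1)] ip_sum_left ip_scale_left)
  also have "\<dots> = (\<Sum>j=1..k. if j = i then ip x (v j) else 0)"
    using assms by (intro sum.cong) (simp_all add: orthonormal_basis_ip)
  also have "\<dots> = ip x (v i)"
    using assms(2) by simp
  finally show ?thesis .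
qed

lemma ip_norm_orth_proj:
  assumes "orthonormal_basis scale ip k v V"
  shows "ip_norm ip (orth_proj ip V x) = sqrt (\<Sum>j=1..k. (norm (ip x (v j)))\<^sup>2)"
proof (rule ip_norm_eq_sqrt)
  let ?p = "orth_proj ip V x"
  \<comment> \<open>Only the left argument is expanded; the right one stays a projection, so that
    \<open>orth_proj_ip_basis\<close> evaluates its coordinates.\<close>
  have "ip ?p ?p = (\<Sum>j=1..k. ip x (v j) * ip (v j) ?p)"
    by (subst (1) orth_proj_eq_sum[OF assms]) (simp add: ip_sum_left ip_scale_left)
  also have "\<dots> = (\<Sum>j=1..k. ip x (v j) * rc_conj (ip x (v j)))"
    by (intro sum.cong refl) (metis ip_conj_sym orth_proj_ip_basis[OF assms])
  also have "\<dots> = of_real (\<Sum>j=1..k. (norm (ip x (v j)))\<^sup>2)"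
    by (simp add: rc_mult_conj scaleR_conv_of_real)
  finally show "ip ?p ?p = of_real (\<Sum>j=1..k. (norm (ip x (v j)))\<^sup>2)" .
qed

text \<open>The residual is orthogonal to every \<open>v j\<close>, hence to the projection, so
  Pythagoras applies to their sum \<open>x\<close>.\<close>

lemma ip_norm_diff_orth_proj:
  assumes "orthonormal_basis scale ip k v V"
  shows "(ip_norm ip (x - orth_proj ip V x))\<^sup>2 =
    (ip_norm ip x)\<^sup>2 - (\<Sum>j=1..k. (norm (ip x (v j)))\<^sup>2)"
proof -
  let ?p = "orth_proj ip V x"
  have "ip (v j) (x - ?p) = 0" if "j \<in> {1..k}" for j
    by (rule ip_eq_0_sym) (simp add: ip_diff_left orth_proj_ip_basis[OF assms that])
  then have "ip ?p (x - ?p) = 0"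
    by (subst (1) orth_proj_eq_sum[OF assms]) (simp add: ip_sum_left ip_scale_left)
  from pythagoras[OF this] show ?thesis
    by (simp add: ip_norm_orth_proj[OF assms] sum_nonneg)
qed

text \<open>With \<open>orth_proj_eq_sum\<close> this expands a vector of a subspace in an
  orthonormal basis of that subspace.\<close>

lemma orth_proj_ident:
  assumes "orthonormal_basis scale ip k v V" "x \<in> V"
  shows "orth_proj ip V x = x"
  unfolding orth_proj_def
proof (rule the_equality)
  fix p assume p: "p \<in> V \<and> (\<forall>w\<in>V. ip (x - p) w = 0)"
  then have "x - p \<in> V"
    using assms by (auto simp: orthonormal_basis_def intro: span_diff)
  with p have "x - p = 0"
    by (intro ip_self_eq_0) blast
  then show "p = x"
    by simp
qed (use assms(2) in \<open>simp add: ip_zero_left\<close>)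

lemma orth_proj_lincomb:
  assumes "orthonormal_basis scale ip k v V"
  shows "orth_proj ip V (\<Sum>i\<in>A. scale (a i) (w i)) = (\<Sum>i\<in>A. scale (a i) (orth_proj ip V (w i)))"
  unfolding orth_proj_eq_sum[OF assms] scale_sum_right scale_scale ip_sum_left scale_sum_left ip_scale_left
  by (rule sum.swap)

text \<open>The bound is independent of \<open>x\<close>, so it shows that the supremum in (i) is
  finite and also bounds it from above.\<close>

lemma ip_norm_residual_le:
  assumes V: "orthonormal_basis scale ip k v V"
    and U: "orthonormal_basis scale ip l u U"
    and x: "x \<in> U" "ip_norm ip x = 1"
  shows "ip_norm ip (x - orth_proj ip V x) \<le> (\<Sum>i=1..l. ip_norm ip (u i - orth_proj ip V (u i)))"
proof -
  have "x = (\<Sum>i=1..l. scale (ip x (u i)) (u i))" (is "x = ?x")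
    using orth_proj_ident[OF U x(1)] orth_proj_eq_sum[OF U] by simp
  then have "x - orth_proj ip V x = ?x - orth_proj ip V ?x"
    by simp
  also have "\<dots> = (\<Sum>i=1..l. scale (ip x (u i)) (u i - orth_proj ip V (u i)))"
    by (simp add: orth_proj_lincomb[OF V] sum_subtractf scale_right_diff_distrib)
  finally have "ip_norm ip (x - orth_proj ip V x) =
      ip_norm ip (\<Sum>i=1..l. scale (ip x (u i)) (u i - orth_proj ip V (u i)))"
    by simp
  also have "\<dots> \<le> (\<Sum>i=1..l. ip_norm ip (u i - orth_proj ip V (u i)))"
  proof (rule ip_norm_lincomb_le)
    fix i assume "i \<in> {1..l}"
    then show "norm (ip x (u i)) \<le> 1"
      using cauchy_schwarz[of x "u i"] ip_norm_orthonormal_basis[OF U] x(2) by simp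
  qed
  finally show ?thesis .
qed

end

text \<open>Schur complement by explicit factorization into \<open>A * B\<close>, with
  \<open>A\<close> upper and \<open>B\<close> lower triangular. All diagonal entries are 1 except
  the corner \<open>?d\<close> of \<open>A\<close>.\<close>

lemma det_bordered_one_mat:
  fixes a :: "'a::comm_ring_1"
  shows "det (mat (Suc k) (Suc k) (\<lambda>(p, q). if p = 0 then (if q = 0 then a else b q)
      else if q = 0 then c p else if p = q then 1 else 0)) = a - (\<Sum>j=1..k. b j * c j)"
    (is "det ?M = ?d")
proof -
  define A where "A = mat (Suc k) (Suc k)
    (\<lambda>(p, q). if p = 0 then (if q = 0 then ?d else b q) else if p = q then 1 else 0)"
  define B where "B = mat (Suc k) (Suc k)
    (\<lambda>(p, q). if p = q then 1 else if q = 0 then c p else (0::'a))"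
  have carrier: "A \<in> carrier_mat (Suc k) (Suc k)" "B \<in> carrier_mat (Suc k) (Suc k)"
    by (simp_all add: A_def B_def)
  have "?M = A * B"
  proof (rule eq_matI)
    fix p q assume "p < dim_row (A * B)" "q < dim_col (A * B)"
    then have pq: "p < Suc k" "q < Suc k"
      using carrier by auto
    have "(A * B) $$ (p, q) = (\<Sum>r=0..<Suc k. A $$ (p, r) * B $$ (r, q))"
      using pq carrier by (simp add: scalar_prod_def)
    also have "\<dots> = ?M $$ (p, q)"
    proof (cases "p = 0")
      case True
      \<comment> \<open>In column 0 the corner \<open>?d\<close> cancels the sum of the
        \<open>b r * c r\<close> and leaves \<open>a\<close>; in column \<open>q > 0\<close> only
        \<open>b q\<close> survives.\<close>
      have "(\<Sum>r=0..<Suc k. A $$ (p, r) * B $$ (r, q)) =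
          ?d * (if q = 0 then 1 else 0) + (\<Sum>r=1..k. b r * (if r = q then 1 else if q = 0 then c r else 0))"
        unfolding atLeast0LessThan lessThan_Suc_atMost
        using pq True by (subst sum.atMost_shift)
          (auto simp: A_def B_def sum.atLeast1_atMost_eq intro!: sum.cong)
      also have "\<dots> = (if q = 0 then a else b q)"
        using pq by (auto simp: if_distrib[of "(*) _"] cong: if_cong)
      finally show ?thesis
        using pq True by simp
    next
      case False
      \<comment> \<open>Every other row of \<open>A\<close> is a unit vector, so the product copies
        row \<open>p\<close> of \<open>B\<close>.\<close>
      have "(\<Sum>r=0..<Suc k. A $$ (p, r) * B $$ (r, q)) = (\<Sum>r=0..<Suc k. if r = p then B $$ (r, q) else 0)"
        using pq False by (intro sum.cong) (auto simp: A_def)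
      then show ?thesis
        using pq False by (simp add: B_def)
    qed
    finally show "?M $$ (p, q) = (A * B) $$ (p, q)" ..
  qed (use carrier in auto)
  moreover have "det A = ?d"
  proof -
    have "det A = prod_list (diag_mat A)"
      using carrier by (intro det_upper_triangular) (auto simp: A_def)
    also have "diag_mat A = ?d # map (\<lambda>_. 1) [1..<Suc k]"
      unfolding diag_mat_def using carrier
      by (simp add: upt_conv_Cons[of 0] A_def del: upt_Suc)
    finally show ?thesis
      by (simp add: map_replicate_const del: upt_Suc)
  qed
  moreover have "det B = 1"
  proof -
    have "det B = prod_list (diag_mat B)"
      using carrier by (intro det_lower_triangular[of "Suc k"]) (auto simp: B_def)
    also have "diag_mat B = map (\<lambda>_. 1) [0..<Suc k]"
      unfolding diag_mat_def using carrier by (auto simp: B_def simp del: upt_Suc)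
    finally show ?thesis
      by (simp add: map_replicate_const del: upt_Suc)
  qed
  ultimately show ?thesis
    using det_mult[OF carrier] by simp
qed

text \<open>Orthonormality turns the Gram matrix into a bordered identity matrix. The equality is
  exact, so (v) becomes (ii) by rewriting.\<close>

lemma (in inner_product_space) std_norm_eq_residual:
  assumes "orthonormal_basis scale ip k v V"
  shows "std_norm ip (x # map v [1..<Suc k]) = ip_norm ip (x - orth_proj ip V x)"
proof -
  let ?xs = "x # map v [1..<Suc k]"
  have len: "length ?xs = Suc k"
    by simp
  \<comment> \<open>Families are indexed from 1 and lists from 0; the leading \<open>x\<close>
    absorbs the shift.\<close>
  have nth: "?xs ! p = (if p = 0 then x else v p)" if "p < Suc k" for p
    using that by (cases p) (simp_all del: upt_Suc)
  have "gram_det ip ?xs = det (mat (Suc k) (Suc k) (\<lambda>(p, q). if p = 0 then (if q = 0 then ip x x else ip x (v q))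
      else if q = 0 then ip (v p) x else if p = q then 1 else 0))"
    unfolding gram_det_def len
  proof (rule arg_cong[where f = det], rule cong_mat)
    fix p q assume "p < Suc k" "q < Suc k"
    then show "(case (p, q) of (p, q) \<Rightarrow> ip (?xs ! p) (?xs ! q)) =
        (case (p, q) of (p, q) \<Rightarrow> if p = 0 then (if q = 0 then ip x x else ip x (v q))
          else if q = 0 then ip (v p) x else if p = q then 1 else 0)"
      by (auto simp: nth orthonormal_basis_ip[OF assms] simp del: upt_Suc)
  qed simp_all
  also have "\<dots> = ip x x - (\<Sum>j=1..k. ip x (v j) * ip (v j) x)"
    by (rule det_bordered_one_mat)
  also have "\<dots> = ip x x - (\<Sum>j=1..k. ip x (v j) * rc_conj (ip x (v j)))"
    by (simp flip: ip_conj_sym[of _ x])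
  also have "\<dots> = of_real ((ip_norm ip (x - orth_proj ip V x))\<^sup>2)"
    unfolding ip_norm_diff_orth_proj[OF assms]
    by (simp add: rc_mult_conj ip_self scaleR_conv_of_real)
  finally show ?thesis
    by (simp add: std_norm_def del: of_real_power)
qed

section \<open>The equivalences\<close>

theorem corollary3p8:
  fixes scale :: "'f::rc_field \<Rightarrow> 'a::ab_group_add \<Rightarrow> 'a"
    and ip :: "'a \<Rightarrow> 'a \<Rightarrow> 'f"
    and k :: nat
    and \<I> :: "nat set set"
    and U :: "nat \<Rightarrow> 'a set" and V :: "'a set"
    and u :: "nat \<Rightarrow> nat \<Rightarrow> 'a" and v :: "nat \<Rightarrow> 'a"
  assumes "k \<ge> 1"
    and "inner_product_space scale ip"
    and "dim_at_least scale k"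
    and "set_ideal \<I>" and "nontrivial_ideal \<I>" and "admissible_ideal \<I>"
    and "\<And>n. k_subspace scale k (U n)"
    and "k_subspace scale k V"
    and "\<And>n. orthonormal_basis scale ip k (u n) (U n)"
    and "orthonormal_basis scale ip k v V"
  shows
    "(ideal_lim_subspace ip \<I> U V
        \<longleftrightarrow> (\<forall>i\<in>{1..k}. ideal_lim \<I> (\<lambda>n. ip_norm ip (u n i - orth_proj ip V (u n i))) 0))
     \<and> ((\<forall>i\<in>{1..k}. ideal_lim \<I> (\<lambda>n. ip_norm ip (u n i - orth_proj ip V (u n i))) 0)
        \<longleftrightarrow> (\<forall>i\<in>{1..k}. ideal_lim \<I> (\<lambda>n. \<Sum>j=1..k. (norm (ip (u n i) (v j)))\<^sup>2) 1))
     \<and> ((\<forall>i\<in>{1..k}. ideal_lim \<I> (\<lambda>n. \<Sum>j=1..k. (norm (ip (u n i) (v j)))\<^sup>2) 1)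
        \<longleftrightarrow> (\<forall>i\<in>{1..k}. ideal_lim \<I> (\<lambda>n. ip_norm ip (orth_proj ip V (u n i))) 1))
     \<and> ((\<forall>i\<in>{1..k}. ideal_lim \<I> (\<lambda>n. ip_norm ip (orth_proj ip V (u n i))) 1)
        \<longleftrightarrow> (\<forall>i\<in>{1..k}. ideal_lim \<I> (\<lambda>n. std_norm ip (u n i # map v [1..<Suc k])) 0))"
proof -
  interpret inner_product_space scale ip by fact
  note basisU = assms(9) and basisV = assms(10)
  let ?F = "ideal_filter \<I>"
  let ?S = "\<lambda>n i. \<Sum>j=1..k. (norm (ip (u n i) (v j)))\<^sup>2"
  let ?res = "\<lambda>x. ip_norm ip (x - orth_proj ip V x)"
  define s where "s n = (SUP x\<in>{x \<in> U n. ip_norm ip x = 1}. ?res x)" for n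
  have res_sq: "(?res (u n i))\<^sup>2 = 1 - ?S n i" if "i \<in> {1..k}" for n i
    using ip_norm_diff_orth_proj[OF basisV, of "u n i"] ip_norm_orthonormal_basis[OF basisU that]
    by simp
  have res_le_s: "?res (u n i) \<le> s n" if "i \<in> {1..k}" for n i
    unfolding s_def
  proof (rule cSUP_upper)
    show "u n i \<in> {x \<in> U n. ip_norm ip x = 1}"
      using orthonormal_basis_in[OF basisU that] ip_norm_orthonormal_basis[OF basisU that] by simp
    \<comment> \<open>A real \<open>SUP\<close> bounds its members only when they are bounded
      above.\<close>
    show "bdd_above (?res ` {x \<in> U n. ip_norm ip x = 1})"
      using ip_norm_residual_le[OF basisV basisU] by (intro bdd_aboveI2) auto
  qed
  have s_le: "s n \<le> (\<Sum>i=1..k. ?res (u n i))" for n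
    unfolding s_def
  proof (rule cSUP_least)
    \<comment> \<open>Since \<open>k\<close> is at least 1, the unit vector \<open>u n 1\<close>
      exists and the supremum is not over the empty set.\<close>
    show "{x \<in> U n. ip_norm ip x = 1} \<noteq> {}"
      using orthonormal_basis_in[OF basisU, of 1] ip_norm_orthonormal_basis[OF basisU, of 1] \<open>k \<ge> 1\<close>
      by auto
  qed (use ip_norm_residual_le[OF basisV basisU] in blast)
  have s_nonneg: "0 \<le> s n" for n
    using res_le_s[of 1 n] \<open>k \<ge> 1\<close> by (force intro: order_trans[OF ip_norm_nonneg])
  \<comment> \<open>\<open>s_nonneg\<close> removes the absolute value in \<open>ideal_lim\<close>,
    which subspace convergence is defined without.\<close>
  have "ideal_lim_subspace ip \<I> U V \<longleftrightarrow> ideal_lim \<I> s 0"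
    unfolding ideal_lim_subspace_def ideal_lim_def s_def[symmetric] by (simp add: s_nonneg)
  also have "\<dots> \<longleftrightarrow> (\<forall>i\<in>{1..k}. ideal_lim \<I> (\<lambda>n. ?res (u n i)) 0)"
    unfolding ideal_lim_iff_tendsto[OF \<open>set_ideal \<I>\<close>]
  proof
    assume "(s \<longlongrightarrow> 0) ?F"
    show "\<forall>i\<in>{1..k}. ((\<lambda>n. ?res (u n i)) \<longlongrightarrow> 0) ?F"
    proof
      fix i assume "i \<in> {1..k}"
      then show "((\<lambda>n. ?res (u n i)) \<longlongrightarrow> 0) ?F"
        by (intro tendsto_sandwich[OF _ _ tendsto_const \<open>(s \<longlongrightarrow> 0) ?F\<close>] always_eventually allI
            ip_norm_nonneg res_le_s)
    qed
  next
    assume "\<forall>i\<in>{1..k}. ((\<lambda>n. ?res (u n i)) \<longlongrightarrow> 0) ?F"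
    then have lim: "((\<lambda>n. \<Sum>i=1..k. ?res (u n i)) \<longlongrightarrow> 0) ?F"
      by (intro tendsto_null_sum) auto
    show "(s \<longlongrightarrow> 0) ?F"
      by (intro tendsto_sandwich[OF _ _ tendsto_const lim] always_eventually allI s_nonneg s_le)
  qed
  finally have i_ii: "ideal_lim_subspace ip \<I> U V \<longleftrightarrow>
      (\<forall>i\<in>{1..k}. ideal_lim \<I> (\<lambda>n. ?res (u n i)) 0)" .
  have ii_iii: "ideal_lim \<I> (\<lambda>n. ?res (u n i)) 0 \<longleftrightarrow> ideal_lim \<I> (\<lambda>n. ?S n i) 1"
    if "i \<in> {1..k}" for i
  proof -
    \<comment> \<open>Passing to squares makes \<open>res_sq\<close> applicable.\<close>
    have "((\<lambda>n. ?res (u n i)) \<longlongrightarrow> 0) ?F \<longleftrightarrow> ((\<lambda>n. sqrt ((?res (u n i))\<^sup>2)) \<longlongrightarrow> sqrt 0) ?F"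
      by simp
    also have "\<dots> \<longleftrightarrow> ((\<lambda>n. (?res (u n i))\<^sup>2) \<longlongrightarrow> 0) ?F"
      by (rule tendsto_sqrt_iff) simp_all
    \<comment> \<open>Subtraction from 1 is its own inverse, so one limit rule gives both
      directions.\<close>
    also have "\<dots> \<longleftrightarrow> ((\<lambda>n. ?S n i) \<longlongrightarrow> 1) ?F"
      unfolding res_sq[OF that]
      using tendsto_diff[OF tendsto_const[of 1], of "\<lambda>n. 1 - ?S n i" 0 ?F]
        tendsto_diff[OF tendsto_const[of 1], of "\<lambda>n. ?S n i" 1 ?F] by auto
    finally show ?thesis
      unfolding ideal_lim_iff_tendsto[OF \<open>set_ideal \<I>\<close>] .
  qed
  have iii_iv: "ideal_lim \<I> (\<lambda>n. ?S n i) 1 \<longleftrightarrow>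
      ideal_lim \<I> (\<lambda>n. ip_norm ip (orth_proj ip V (u n i))) 1" for i
    unfolding ideal_lim_iff_tendsto[OF \<open>set_ideal \<I>\<close>] ip_norm_orth_proj[OF basisV]
    using tendsto_sqrt_iff[of "\<lambda>n. ?S n i" 1 ?F] by (simp add: sum_nonneg)
  show ?thesis
    unfolding std_norm_eq_residual[OF basisV] i_ii using ii_iii iii_iv by simp
qed

end
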